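(* Let $P\in\mathrm{Gr}(n,p)$ and $\Delta,\Gamma\in T_P\mathrm{Gr}(n,p)$. Then the parallel transport $\mathbb{P}_\Delta(\mathrm{Exp}^{\mathrm{Gr}}_P(t\Gamma))$ of $\Delta$ along the geodesic $$\mathrm{Exp}^{\mathrm{Gr}}_P(t\Gamma)=\exp_m(t[\Gamma,P])\,P\,\exp_m(-t[\Gamma,P])$$ is given by $$\mathbb{P}_\Delta(\mathrm{Exp}^{\mathrm{Gr}}_P(t\Gamma))=\exp_m(t[\Gamma,P])\,\Delta\,\exp_m(-t[\Gamma,P]).$$
   Context: Let $1\le p\le n$ be integers. $\mathrm{Gr}(n,p)=\{P\in\mathbb{R}^{n\times n}: P^T=P,\ P^2=P,\ \mathrm{rank}\,P=p\}$, an embedded submanifold of the space $\mathrm{Sym}_n$ of symmetric $n\times n$ matrices, with tangent space $T_P\mathrm{Gr}(n,p)=\{\Delta=\Delta^T: \Delta P+P\Delta=\Delta\}$ and Riemannian metric $g_P(\Delta_1,\Delta_2)=\frac12\mathrm{tr}(\Delta_1\Delta_2)$. $\mathrm{Exp}^{\mathrm{Gr}}_P$ is the Riemannian exponential map, $\exp_m$ is the matrix exponential and $[A,B]=AB-BA$. Since the metric is (half of) the one induced from the Euclidean space $\mathrm{Sym}_n$, the Levi-Civita connection is $\nabla_YX=\Pi_{T_P\mathrm{Gr}}(\mathrm{d}X_P(Y))$ for $Y\in T_P\mathrm{Gr}(n,p)$, where $\mathrm{d}X_P(Y)$ is the usual directional derivative (of a smooth extension of $X$) in $\mathrm{Sym}_n$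 and $\Pi_{T_P\mathrm{Gr}}(S)=(I_n-P)SP+PS(I_n-P)$ is the orthogonal projection onto the tangent space. The parallel transport of $\Delta\in T_P\mathrm{Gr}(n,p)$ along a curve $\gamma$ with $\gamma(0)=P$ is the unique smooth vector field $t\mapsto V(t)\in T_{\gamma(t)}\mathrm{Gr}(n,p)$ along $\gamma$ with $V(0)=\Delta$ and vanishing covariant derivative along $\gamma$, i.e. $\Pi_{T_{\gamma(t)}\mathrm{Gr}}(\dot V(t))=0$ for all $t$; $\mathbb{P}_\Delta(\gamma(t))$ denotes $V(t)$. *)

theory Defs
  imports "HOL-Analysis.Analysis"
begin

type_synonym 'n sqmat = "real ^ 'n ^ 'n"

text \<open>The multiplication and power of the type class instances on vectors act componentwise,
  hence powers of a matrix are iterates of the matrix product.\<close>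

definition mat_exp :: "'n::finite sqmat \<Rightarrow> 'n sqmat" where
  "mat_exp A = (\<Sum>k. (1 / fact k) *\<^sub>R (((**) A ^^ k) (mat 1)))"

definition commutator :: "'n::finite sqmat \<Rightarrow> 'n sqmat \<Rightarrow> 'n sqmat" where
  "commutator A B = A ** B - B ** A"

definition Gr :: "nat \<Rightarrow> ('n::finite sqmat) set" where
  "Gr p = {P. transpose P = P \<and> P ** P = P \<and> rank P = p}"

definition gr_tangent :: "'n::finite sqmat \<Rightarrow> ('n sqmat) set" where
  "gr_tangent P = {\<Delta>. transpose \<Delta> = \<Delta> \<and> \<Delta> ** P + P ** \<Delta> = \<Delta>}"

definition gr_metric :: "'n::finite sqmat \<Rightarrow> 'n sqmat \<Rightarrow> real" where
  "gr_metric \<Delta>1 \<Delta>2 = trace (\<Delta>1 ** \<Delta>2) / 2"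

definition gr_proj :: "'n::finite sqmat \<Rightarrow> 'n sqmat \<Rightarrow> 'n sqmat" where
  "gr_proj P S = (mat 1 - P) ** S ** P + P ** S ** (mat 1 - P)"

text \<open>A curve in an embedded submanifold is smooth iff it is smooth as a curve in the
  ambient Euclidean space.\<close>

definition smooth_curve :: "(real \<Rightarrow> 'a::real_normed_vector) \<Rightarrow> bool" where
  "smooth_curve c \<longleftrightarrow>
     (\<exists>D :: nat \<Rightarrow> real \<Rightarrow> 'a. D 0 = c \<and>
        (\<forall>k t. (D k has_vector_derivative D (Suc k) t) (at t)))"

definition velocity :: "(real \<Rightarrow> 'a::real_normed_vector) \<Rightarrow> real \<Rightarrow> 'a" where
  "velocity c t = vector_derivative c (at t)"

text \<open>Covariant derivative along \<open>\<gamma>\<close> of a field \<open>V\<close> along \<open>\<gamma>\<close>. The Levi-Civita connection of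
  the metric is the tangential part of the Euclidean derivative, since the metric is half the one
  induced from the symmetric matrices and \<open>gr_proj\<close> is the orthogonal projection onto the
  tangent space (proved below).\<close>

definition gr_covariant_deriv ::
    "(real \<Rightarrow> 'n::finite sqmat) \<Rightarrow> (real \<Rightarrow> 'n sqmat) \<Rightarrow> real \<Rightarrow> 'n sqmat" where
  "gr_covariant_deriv \<gamma> V t = gr_proj (\<gamma> t) (velocity V t)"

definition gr_parallel_field ::
    "(real \<Rightarrow> 'n::finite sqmat) \<Rightarrow> (real \<Rightarrow> 'n sqmat) \<Rightarrow> bool" where
  "gr_parallel_field \<gamma> V \<longleftrightarrow>
     smooth_curve V \<and> (\<forall>t. V t \<in> gr_tangent (\<gamma> t)) \<and> (\<forall>t. gr_covariant_deriv \<gamma> V t = 0)"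

text \<open>\<open>gr_parallel_transport \<gamma> \<Delta> t\<close> transports \<open>\<Delta>\<close> from \<open>\<gamma> 0\<close> to \<open>\<gamma> t\<close>.\<close>

definition gr_parallel_transport ::
    "(real \<Rightarrow> 'n::finite sqmat) \<Rightarrow> 'n sqmat \<Rightarrow> real \<Rightarrow> 'n sqmat" where
  "gr_parallel_transport \<gamma> \<Delta> = (THE V. gr_parallel_field \<gamma> V \<and> V 0 = \<Delta>)"

definition gr_geodesic :: "nat \<Rightarrow> (real \<Rightarrow> 'n::finite sqmat) \<Rightarrow> bool" where
  "gr_geodesic p \<gamma> \<longleftrightarrow>
     smooth_curve \<gamma> \<and> (\<forall>t. \<gamma> t \<in> Gr p) \<and> (\<forall>t. gr_covariant_deriv \<gamma> (velocity \<gamma>) t = 0)"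

text \<open>Geodesics are taken on all of the real line, as the Grassmannian is compact and hence
  geodesically complete.\<close>

definition gr_exp :: "nat \<Rightarrow> 'n::finite sqmat \<Rightarrow> 'n sqmat \<Rightarrow> 'n sqmat" where
  "gr_exp p P \<Gamma> = (THE \<gamma>. gr_geodesic p \<gamma> \<and> \<gamma> 0 = P \<and> velocity \<gamma> 0 = \<Gamma>) 1"

lemma transpose_add_mat: "transpose (A + B) = transpose A + transpose (B :: 'n::finite sqmat)"
  by (simp add: transpose_def vec_eq_iff)

lemma transpose_diff_mat: "transpose (A - B) = transpose A - transpose (B :: 'n::finite sqmat)"
  by (simp add: transpose_def vec_eq_iff)

lemma matrix_add_rdistrib: "(A + B) ** C = A ** C + (B :: 'n sqmat) ** (C :: 'n::finite sqmat)"
  by (simp add: matrix_matrix_mult_def vec_eq_iff sum.distrib distrib_right)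

lemma matrix_diff_ldistrib: "A ** (B - C) = (A :: 'n sqmat) ** B - A ** (C :: 'n::finite sqmat)"
  by (simp add: matrix_matrix_mult_def vec_eq_iff sum_subtractf right_diff_distrib)

lemma matrix_diff_rdistrib: "(A - B) ** C = A ** C - (B :: 'n sqmat) ** (C :: 'n::finite sqmat)"
  by (simp add: matrix_matrix_mult_def vec_eq_iff sum_subtractf left_diff_distrib)

lemmas matrix_ring_simps =
  matrix_add_ldistrib matrix_add_rdistrib matrix_diff_ldistrib matrix_diff_rdistrib matrix_mul_assoc

lemma gr_proj_in_tangent:
  assumes "P \<in> Gr p" and "transpose S = S"
  shows "gr_proj P S \<in> gr_tangent P"
proof -
  have PP: "P ** P = P" and tP: "transpose P = P"
    using assms by (auto simp: Gr_def)
  have PP': "X ** P ** P = X ** P" for X :: "'a sqmat"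
    by (simp add: PP flip: matrix_mul_assoc)
  define A B where "A = (mat 1 - P) ** S ** P" and "B = P ** S ** (mat 1 - P)"
  have AB: "gr_proj P S = A + B"
    by (simp add: gr_proj_def A_def B_def)
  have "A ** P = A" "P ** A = 0" "P ** B = B" "B ** P = 0"
    by (simp_all add: A_def B_def matrix_ring_simps PP PP')
  moreover have "transpose A = B" "transpose B = A"
    using tP assms(2)
    by (simp_all add: A_def B_def matrix_transpose_mul transpose_diff_mat matrix_mul_assoc)
  ultimately show ?thesis
    by (simp add: gr_tangent_def AB transpose_add_mat matrix_ring_simps add.commute)
qed

lemma gr_proj_orthogonal:
  assumes "P \<in> Gr p" and "\<Delta> \<in> gr_tangent P"
  shows "gr_metric (S - gr_proj P S) \<Delta> = 0"
proof -
  have PP: "P ** P = P" using assms by (auto simp: Gr_def)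
  have PP': "X ** P ** P = X ** P" for X :: "'a sqmat"
    by (simp add: PP flip: matrix_mul_assoc)
  have D: "\<Delta> = \<Delta> ** P + P ** \<Delta>" using assms by (auto simp: gr_tangent_def)
  have PDP: "P ** \<Delta> ** P = 0"
  proof -
    have "P ** \<Delta> ** P = P ** (\<Delta> ** P + P ** \<Delta>) ** P" using D by simp
    also have "\<dots> = P ** \<Delta> ** P + P ** \<Delta> ** P" by (simp add: matrix_ring_simps PP PP')
    finally show ?thesis by simp
  qed
  have t1: "trace (P ** S ** \<Delta>) = trace (S ** \<Delta> ** P)"
    by (metis trace_mul_sym matrix_mul_assoc)
  have t2: "trace (P ** S ** P ** \<Delta>) = trace (S ** (P ** \<Delta> ** P))"
    by (metis trace_mul_sym matrix_mul_assoc)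
  have t3: "trace (S ** \<Delta>) = trace (S ** \<Delta> ** P) + trace (S ** P ** \<Delta>)"
    by (subst D) (simp add: matrix_ring_simps trace_add)
  have t4: "trace ((mat 1 - P) ** S ** P ** \<Delta>) = trace (S ** P ** \<Delta>)"
    using t2 by (simp add: matrix_ring_simps trace_sub PDP trace_0[simplified])
  have "trace (P ** S ** P ** \<Delta>) = 0"
    using t2 by (simp add: PDP trace_0[simplified])
  then have t5: "trace (P ** S ** (mat 1 - P) ** \<Delta>) = trace (S ** \<Delta> ** P)"
    using t1 by (simp add: matrix_ring_simps trace_sub)
  have "trace ((S - gr_proj P S) ** \<Delta>) = trace (S ** \<Delta>) -
      (trace ((mat 1 - P) ** S ** P ** \<Delta>) + trace (P ** S ** (mat 1 - P) ** \<Delta>))"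
    by (simp only: gr_proj_def matrix_diff_rdistrib[of S] matrix_add_rdistrib trace_sub trace_add)
  also have "\<dots> = 0"
    unfolding t3 t4 t5 by simp
  finally show ?thesis
    by (simp add: gr_metric_def)
qed

end

theory Submission
  imports Defs
begin

text \<open>Put \<open>\<Omega> = [\<Gamma>, P]\<close> and conjugate by \<open>exp (t \<Omega>)\<close>. Conjugation turns \<open>X\<close> into a curve whose
  derivative is the conjugate of \<open>[\<Omega>, X]\<close>, and it intertwines the tangential projections at \<open>P\<close> and
  at the conjugate of \<open>P\<close>. For tangent \<open>\<Delta>\<close> the bracket \<open>[\<Omega>, \<Delta>]\<close> commutes with \<open>P\<close>, so it has no
  tangential part; hence the conjugate of \<open>\<Delta>\<close> is parallel, and the case \<open>\<Delta> = \<Gamma> = [\<Omega>, P]\<close> is the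
  geodesic equation. Parallel fields are unique because a parallel field has constant norm.
  Geodesics are unique because \<open>[\<gamma>', \<gamma>]\<close> is constant along a geodesic \<open>\<gamma>\<close>, as \<open>\<gamma>''\<close> is normal and
  so commutes with \<open>\<gamma>\<close>; thus \<open>\<gamma>\<close> solves the linear equation \<open>\<gamma>' = [[\<gamma>', \<gamma>], \<gamma>] = [\<Omega>, \<gamma>]\<close>.\<close>

section \<open>Exponential series\<close>

lemma matrix_mult_bounded_bilinear:
  "bounded_bilinear ((**) :: 'n::finite sqmat \<Rightarrow> 'n sqmat \<Rightarrow> 'n sqmat)"
  unfolding bilinear_conv_bounded_bilinear[symmetric] bilinear_def linear_iff
  by (simp add: vec_eq_iff matrix_matrix_mult_def sum.distrib sum_distrib_left algebra_simps)

interpretation mat: bounded_bilinear "(**) :: 'n::finite sqmat \<Rightarrow> 'n sqmat \<Rightarrow> 'n sqmat"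
  by (rule matrix_mult_bounded_bilinear)

text \<open>Comparison with the scalar series of \<open>C * exp (\<bar>t\<bar> * M)\<close>; the
  geometric bound is the one satisfied by powers of a fixed matrix.\<close>

lemma exp_series_summable:
  fixes c :: "nat \<Rightarrow> 'a::banach"
  assumes "\<And>k. norm (c k) \<le> C * M ^ k"
  shows "summable (\<lambda>k. (t ^ k / fact k) *\<^sub>R c k)"
proof (rule summable_comparison_test')
  show "summable (\<lambda>k. C * (inverse (fact k) * (\<bar>t\<bar> * M) ^ k))"
    by (intro summable_mult summable_exp)
  show "norm ((t ^ k / fact k) *\<^sub>R c k) \<le> C * (inverse (fact k) * (\<bar>t\<bar> * M) ^ k)" for k
    using mult_left_mono[OF assms[of k], of "\<bar>t\<bar> ^ k / fact k"]
    by (simp add: power_abs power_mult_distrib field_simps)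
qed

text \<open>Pairing with a fixed vector \<open>b\<close> reduces this to termwise differentiation of
  real power series.\<close>

lemma exp_series_has_vector_derivative:
  fixes c :: "nat \<Rightarrow> 'a::euclidean_space"
  assumes c: "\<And>k. norm (c k) \<le> C * M ^ k"
  shows "((\<lambda>t. \<Sum>k. (t ^ k / fact k) *\<^sub>R c k) has_vector_derivative
           (\<Sum>k. (t ^ k / fact k) *\<^sub>R c (Suc k))) (at t)"
proof -
  have c': "norm (c (Suc k)) \<le> C * M * M ^ k" for k
    using c[of "Suc k"] by (simp add: mult.assoc)
  have inner_series: "(\<Sum>k. (s ^ k / fact k) *\<^sub>R d k) \<bullet> b = (\<Sum>k. (d k \<bullet> b / fact k) * s ^ k)"
    "summable (\<lambda>k. (d k \<bullet> b / fact k) * s ^ k)"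
    if "\<And>k. norm (d k) \<le> K * M ^ k" for d :: "nat \<Rightarrow> 'a" and K b s
    using bounded_linear.suminf[OF bounded_linear_inner_left exp_series_summable[OF that]]
      bounded_linear.summable[OF bounded_linear_inner_left exp_series_summable[OF that]]
    by (simp_all add: field_simps)
  have "((\<lambda>t. (\<Sum>k. (t ^ k / fact k) *\<^sub>R c k) \<bullet> b) has_field_derivative
          (\<Sum>k. (t ^ k / fact k) *\<^sub>R c (Suc k)) \<bullet> b) (at t)" for b
  proof -
    \<comment> \<open>The factor \<open>Suc k\<close> produced by \<open>diffs\<close> cancels
      against \<open>fact (Suc k)\<close>, so only the index of \<open>c\<close> shifts.\<close>
    have "diffs (\<lambda>k. c k \<bullet> b / fact k) = (\<lambda>k. c (Suc k) \<bullet> b / fact k)"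
      by (simp add: diffs_def fun_eq_iff del: of_nat_Suc)
    then show ?thesis
      using termdiffs_strong_converges_everywhere[OF inner_series(2)[OF c], of b t]
      by (simp add: inner_series(1)[OF c] inner_series(1)[OF c'])
  qed
  then show ?thesis
    unfolding has_vector_derivative_def
    by (subst has_derivative_componentwise_within)
      (simp add: has_field_derivative_def mult_commute_abs)
qed

lemma constant_if_vector_derivative_zero:
  fixes f :: "real \<Rightarrow> 'a::real_normed_vector"
  assumes "\<And>t. (f has_vector_derivative 0) (at t)"
  shows "f s = f t"
  using has_vector_derivative_zero_constant[of UNIV f] assms by (metis UNIV_I convex_UNIV)

section \<open>The matrix exponential\<close>

lemma funpow_mult_commute:
  fixes A :: "'n::finite sqmat"
  shows "((**) A ^^ k) (mat 1) ** A = ((**) A ^^ Suc k) (mat 1)"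
  by (induction k) (simp_all flip: matrix_mul_assoc)

lemma funpow_mult_scaleR:
  fixes A :: "'n::finite sqmat"
  shows "((**) (t *\<^sub>R A) ^^ k) (mat 1) = t ^ k *\<^sub>R ((**) A ^^ k) (mat 1)"
  by (induction k) (simp_all add: mat.scaleR_left mat.scaleR_right)

text \<open>The norm is Euclidean on the entries, so \<open>mat 1\<close> need not have norm 1, and
  submultiplicativity holds up to the constant \<open>K\<close> of the bounded bilinear product.
  Hence the prefactor, and \<open>M = norm A * K\<close>.\<close>

lemma funpow_mult_bound:
  fixes A :: "'n::finite sqmat"
  obtains M where "\<And>k. norm (((**) A ^^ k) (mat 1)) \<le> norm (mat 1 :: 'n sqmat) * M ^ k"
proof -
  obtain K where K: "K > 0" "\<And>(A :: 'n sqmat) (B :: 'n sqmat). norm (A ** B) \<le> norm A * norm B * K"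
    using mat.pos_bounded by blast
  have "norm (((**) A ^^ k) (mat 1)) \<le> norm (mat 1 :: 'n sqmat) * (norm A * K) ^ k" for k
  proof (induction k)
    case (Suc k)
    have "norm (((**) A ^^ Suc k) (mat 1)) \<le> (norm A * K) * norm (((**) A ^^ k) (mat 1))"
      using K(2)[of A "((**) A ^^ k) (mat 1)"] by (simp add: algebra_simps)
    also have "\<dots> \<le> (norm A * K) * (norm (mat 1 :: 'n sqmat) * (norm A * K) ^ k)"
      using K(1) Suc.IH by (intro mult_left_mono) auto
    finally show ?case by (simp add: algebra_simps)
  qed simp
  then show ?thesis by (rule that)
qed

lemma mat_exp_scaleR:
  "mat_exp (t *\<^sub>R A) = (\<Sum>k. (t ^ k / fact k) *\<^sub>R ((**) A ^^ k) (mat 1))"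
  by (simp add: mat_exp_def funpow_mult_scaleR)

lemma mat_exp_0 [simp]: "mat_exp 0 = (mat 1 :: 'n::finite sqmat)"
proof -
  have "mat_exp (0 :: 'n sqmat) = (\<Sum>k. (0 ^ k / fact k) *\<^sub>R ((**) 0 ^^ k) (mat 1))"
    using mat_exp_scaleR[of 0 0] by simp
  also have "\<dots> = (\<Sum>k\<in>{0}. (0 ^ k / fact k) *\<^sub>R ((**) 0 ^^ k) (mat 1))"
    by (intro suminf_finite) auto
  finally show ?thesis by simp
qed

text \<open>Multiplying by \<open>A\<close> on either side and differentiating in \<open>t\<close>
  all give the series with the power of \<open>A\<close> shifted by one.\<close>

lemma mat_exp_commute: "mat_exp (t *\<^sub>R A) ** A = A ** mat_exp (t *\<^sub>R A)"
  and mat_exp_has_vector_derivative: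
    "((\<lambda>t. mat_exp (t *\<^sub>R A)) has_vector_derivative A ** mat_exp (t *\<^sub>R A)) (at t)"
  for A :: "'n::finite sqmat"
proof -
  obtain M where M: "\<And>k. norm (((**) A ^^ k) (mat 1)) \<le> norm (mat 1 :: 'n sqmat) * M ^ k"
    using funpow_mult_bound[of A] by blast
  note summable = exp_series_summable[OF M, of t]
  have left: "A ** mat_exp (t *\<^sub>R A) = (\<Sum>k. (t ^ k / fact k) *\<^sub>R ((**) A ^^ Suc k) (mat 1))"
    unfolding mat_exp_scaleR
    by (subst bounded_linear.suminf[OF mat.bounded_linear_right summable]) (simp add: mat.scaleR_right)
  have right: "mat_exp (t *\<^sub>R A) ** A = (\<Sum>k. (t ^ k / fact k) *\<^sub>R ((**) A ^^ Suc k) (mat 1))"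
    unfolding mat_exp_scaleR
    by (subst bounded_linear.suminf[OF mat.bounded_linear_left summable])
      (simp only: mat.scaleR_left funpow_mult_commute)
  show "mat_exp (t *\<^sub>R A) ** A = A ** mat_exp (t *\<^sub>R A)"
    by (simp only: left right)
  show "((\<lambda>t. mat_exp (t *\<^sub>R A)) has_vector_derivative A ** mat_exp (t *\<^sub>R A)) (at t)"
    unfolding left unfolding mat_exp_scaleR by (rule exp_series_has_vector_derivative[OF M])
qed

lemma mat_exp_minus_commute: "mat_exp (- (t *\<^sub>R A)) ** A = A ** mat_exp (- (t *\<^sub>R A))"
  for A :: "'n::finite sqmat"
  using mat_exp_commute[of "- t" A] by simp

lemma mat_exp_minus_has_vector_derivative:
  "((\<lambda>t. mat_exp (- (t *\<^sub>R A))) has_vector_derivative - (A ** mat_exp (- (t *\<^sub>R A)))) (at t)"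
  for A :: "'n::finite sqmat"
  using mat_exp_has_vector_derivative[of "- A" t] by (simp add: mat.minus_left)

lemma mat_exp_mult_minus: "mat_exp (t *\<^sub>R A) ** mat_exp (- (t *\<^sub>R A)) = mat 1"
  for A :: "'n::finite sqmat"
proof -
  have "((\<lambda>t. mat_exp (t *\<^sub>R A) ** mat_exp (- (t *\<^sub>R A))) has_vector_derivative 0) (at t)" for t
    by (rule has_vector_derivative_eq_rhs[OF mat.has_vector_derivative[OF
            mat_exp_has_vector_derivative mat_exp_minus_has_vector_derivative]])
      (simp add: mat.minus_right matrix_mul_assoc mat_exp_commute)
  from constant_if_vector_derivative_zero[OF this, of t 0] show ?thesis by simp
qed

lemma mat_exp_minus_mult: "mat_exp (- (t *\<^sub>R A)) ** mat_exp (t *\<^sub>R A) = mat 1"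
  for A :: "'n::finite sqmat"
  using mat_exp_mult_minus[of t "- A"] by simp

lemma mat_exp_mult_minus': "X ** mat_exp (t *\<^sub>R A) ** mat_exp (- (t *\<^sub>R A)) = X"
  and mat_exp_minus_mult': "X ** mat_exp (- (t *\<^sub>R A)) ** mat_exp (t *\<^sub>R A) = X"
  for A X :: "'n::finite sqmat"
  by (simp_all add: mat_exp_mult_minus mat_exp_minus_mult flip: matrix_mul_assoc)

lemma bounded_linear_transpose: "bounded_linear (transpose :: 'n::finite sqmat \<Rightarrow> 'n sqmat)"
  unfolding linear_conv_bounded_linear[symmetric] linear_iff
  by (simp add: transpose_def vec_eq_iff)

text \<open>For skew \<open>A\<close>, the two terms in the derivative of
  \<open>transpose (?E t) ** ?E t\<close> cancel, so this product keeps its value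
  \<open>mat 1\<close> from \<open>t = 0\<close>.\<close>

lemma transpose_mat_exp_skew:
  fixes A :: "'n::finite sqmat"
  assumes "transpose A = - A"
  shows "transpose (mat_exp (t *\<^sub>R A)) = mat_exp (- (t *\<^sub>R A))"
proof -
  let ?E = "\<lambda>t. mat_exp (t *\<^sub>R A)"
  have "((\<lambda>t. transpose (?E t) ** ?E t) has_vector_derivative 0) (at t)" for t
    by (rule has_vector_derivative_eq_rhs[OF mat.has_vector_derivative[OF
            bounded_linear.has_vector_derivative[OF bounded_linear_transpose
              mat_exp_has_vector_derivative] mat_exp_has_vector_derivative]])
      (simp add: matrix_transpose_mul assms mat.minus_left mat.minus_right matrix_mul_assoc)
  from constant_if_vector_derivative_zero[OF this, of t 0]
  have "transpose (?E t) ** ?E t = mat 1" by (simp add: transpose_mat)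
  then show ?thesis
    by (metis mat_exp_mult_minus' matrix_mul_lid)
qed

section \<open>Conjugation by a one-parameter group\<close>

text \<open>Both formulas of the theorem have this shape, with \<open>X = P\<close> and
  \<open>X = \<Delta>\<close>. Time comes last so that \<open>exp_conj A X\<close> is itself a
  curve.\<close>

definition exp_conj :: "'n::finite sqmat \<Rightarrow> 'n sqmat \<Rightarrow> real \<Rightarrow> 'n sqmat" where
  "exp_conj A X t = mat_exp (t *\<^sub>R A) ** X ** mat_exp (- (t *\<^sub>R A))"

lemma exp_conj_at_0 [simp]: "exp_conj A X 0 = X"
  by (simp add: exp_conj_def)

lemma exp_conj_scaleR: "exp_conj (s *\<^sub>R A) X t = exp_conj A X (t * s)"
  by (simp add: exp_conj_def)

lemma exp_conj_mult: "exp_conj A X t ** exp_conj A Y t = exp_conj A (X ** Y) t"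
  by (simp add: exp_conj_def matrix_mul_assoc mat_exp_minus_mult')

lemma exp_conj_add: "exp_conj A X t + exp_conj A Y t = exp_conj A (X + Y) t"
  by (simp add: exp_conj_def matrix_ring_simps)

lemma exp_conj_diff: "exp_conj A X t - exp_conj A Y t = exp_conj A (X - Y) t"
  by (simp add: exp_conj_def matrix_ring_simps)

lemma exp_conj_zero [simp]: "exp_conj A 0 t = 0"
  by (simp add: exp_conj_def)

lemma exp_conj_one [simp]: "exp_conj A (mat 1) t = mat 1"
  by (simp add: exp_conj_def mat_exp_mult_minus)

lemma rank_exp_conj: "rank (exp_conj A X t) = rank X"
proof (rule antisym)
  show "rank (exp_conj A X t) \<le> rank X"
    unfolding exp_conj_def by (meson order_trans rank_mul_le_left rank_mul_le_right)
  have "X = mat_exp (- (t *\<^sub>R A)) ** exp_conj A X t ** mat_exp (t *\<^sub>R A)"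
    by (simp add: exp_conj_def matrix_mul_assoc mat_exp_minus_mult mat_exp_minus_mult')
  then show "rank X \<le> rank (exp_conj A X t)"
    by (metis order_trans rank_mul_le_left rank_mul_le_right)
qed

lemma transpose_exp_conj_skew:
  assumes "transpose A = - A"
  shows "transpose (exp_conj A X t) = exp_conj A (transpose X) t"
  using transpose_mat_exp_skew[OF assms, of t] transpose_mat_exp_skew[OF assms, of "- t"]
  by (simp add: exp_conj_def matrix_transpose_mul matrix_mul_assoc)

lemma exp_conj_has_vector_derivative:
  "(exp_conj A X has_vector_derivative exp_conj A (commutator A X) t) (at t)"
  unfolding exp_conj_def[abs_def]
  by (rule has_vector_derivative_eq_rhs[OF mat.has_vector_derivative[OF
          mat.has_vector_derivative[OF mat_exp_has_vector_derivative has_vector_derivative_const]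
          mat_exp_minus_has_vector_derivative]])
    (simp add: commutator_def matrix_ring_simps mat.minus_right mat_exp_commute)

lemma velocity_exp_conj: "velocity (exp_conj A X) = exp_conj A (commutator A X)"
  by (simp add: velocity_def fun_eq_iff vector_derivative_at[OF exp_conj_has_vector_derivative])

lemma smooth_curve_exp_conj: "smooth_curve (exp_conj A X)"
  unfolding smooth_curve_def
  \<comment> \<open>Each derivative conjugates one further bracket with \<open>A\<close>.\<close>
  by (intro exI[of _ "\<lambda>k. exp_conj A ((commutator A ^^ k) X)"])
    (simp add: exp_conj_has_vector_derivative)

text \<open>Uniqueness for the linear equation \<open>X' = [A, X]\<close>: undoing the conjugation
  leaves a curve with zero derivative.\<close>

lemma eq_exp_conj_if_commutator_derivative:
  assumes X: "\<And>t. (X has_vector_derivative commutator A (X t)) (at t)"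
  shows "X t = exp_conj A (X 0) t"
proof -
  let ?Y = "\<lambda>t. mat_exp (- (t *\<^sub>R A)) ** X t ** mat_exp (t *\<^sub>R A)"
  have "(?Y has_vector_derivative 0) (at t)" for t
    by (rule has_vector_derivative_eq_rhs[OF mat.has_vector_derivative[OF
            mat.has_vector_derivative[OF mat_exp_minus_has_vector_derivative X]
            mat_exp_has_vector_derivative]])
      (simp add: commutator_def matrix_ring_simps mat.minus_left mat_exp_minus_commute)
  from constant_if_vector_derivative_zero[OF this, of t 0]
  have "?Y t = X 0" by simp
  then show ?thesis
    by (simp add: exp_conj_def matrix_mul_assoc mat_exp_mult_minus mat_exp_mult_minus' flip: \<open>?Y t = X 0\<close>)
qed

lemma smooth_curve_has_vector_derivative:
  assumes "smooth_curve c"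
  shows "(c has_vector_derivative velocity c t) (at t)"
    and "(velocity c has_vector_derivative velocity (velocity c) t) (at t)"
proof -
  obtain D where D: "D 0 = c" "\<And>k t. (D k has_vector_derivative D (Suc k) t) (at t)"
    using assms unfolding smooth_curve_def by blast
  have "velocity (D k) = D (Suc k)" for k
    unfolding velocity_def fun_eq_iff using D(2) by (blast intro: vector_derivative_at)
  then show "(c has_vector_derivative velocity c t) (at t)"
    "(velocity c has_vector_derivative velocity (velocity c) t) (at t)"
    using D by metis+
qed

section \<open>Tangent and normal directions\<close>

lemma idempotent_assoc:
  fixes P :: "'n::finite sqmat"
  assumes "P ** P = P"
  shows "X ** P ** P = X ** P"
  by (simp add: assms flip: matrix_mul_assoc)

text \<open>In blocks relative to \<open>P\<close> and \<open>mat 1 - P\<close>,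
  \<open>gr_proj\<close> keeps the off-diagonal blocks; these vanish exactly for matrices commuting
  with \<open>P\<close>.\<close>

lemma gr_proj_eq_0_iff_commute:
  fixes P :: "'n::finite sqmat"
  assumes PP: "P ** P = P"
  shows "gr_proj P S = 0 \<longleftrightarrow> commutator S P = 0"
proof
  assume 0: "gr_proj P S = 0"
  \<comment> \<open>Multiplication by \<open>P\<close> on the left or right isolates one
    off-diagonal block. If both vanish, \<open>P ** S\<close> and \<open>S ** P\<close> equal
    \<open>P ** S ** P\<close>.\<close>
  have "P ** S - P ** S ** P = P ** gr_proj P S" "S ** P - P ** S ** P = gr_proj P S ** P"
    unfolding gr_proj_def matrix_ring_simps by (simp_all add: PP idempotent_assoc[OF PP])
  then show "commutator S P = 0"
    by (simp add: 0 commutator_def)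
next
  assume "commutator S P = 0"
  then have SP: "S ** P = P ** S" by (simp add: commutator_def)
  moreover have "P ** S ** P = P ** S"
    by (metis SP PP matrix_mul_assoc)
  ultimately show "gr_proj P S = 0"
    by (simp add: gr_proj_def matrix_ring_simps)
qed

lemma tangent_sandwich:
  fixes P :: "'n::finite sqmat"
  assumes PP: "P ** P = P" and D: "\<Delta> ** P + P ** \<Delta> = \<Delta>"
  shows "P ** \<Delta> ** P = 0"
proof -
  have "P ** \<Delta> ** P = P ** (\<Delta> ** P + P ** \<Delta>) ** P" using D by simp
  also have "\<dots> = P ** \<Delta> ** P + P ** \<Delta> ** P"
    by (simp add: matrix_ring_simps PP idempotent_assoc[OF PP])
  finally show ?thesis by simp
qed

text \<open>The double bracket expands to \<open>\<Delta> ** P + P ** \<Delta>\<close> minus twice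
  the vanishing \<open>P ** \<Delta> ** P\<close>. Thus the generator \<open>[\<Gamma>, P]\<close>
  recovers the initial velocity.\<close>

lemma commutator_commutator_tangent:
  fixes P :: "'n::finite sqmat"
  assumes PP: "P ** P = P" and D: "\<Delta> ** P + P ** \<Delta> = \<Delta>"
  shows "commutator (commutator \<Delta> P) P = \<Delta>"
  using D tangent_sandwich[OF assms]
  by (simp add: commutator_def matrix_ring_simps PP idempotent_assoc[OF PP])

text \<open>Tangent vectors are off-diagonal relative to \<open>P\<close>, and so is
  \<open>[\<Gamma>, P]\<close>. A product of two off-diagonal matrices is block diagonal and hence
  commutes with \<open>P\<close>.\<close>

lemma commutator_tangent_normal:
  fixes P :: "'n::finite sqmat"
  assumes PP: "P ** P = P" and G: "\<Gamma> ** P + P ** \<Gamma> = \<Gamma>" and D: "\<Delta> ** P + P ** \<Delta> = \<Delta>"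
  shows "commutator (commutator (commutator \<Gamma> P) \<Delta>) P = 0"
proof -
  have DP: "\<Delta> ** P = \<Delta> - P ** \<Delta>" and GP: "\<Gamma> ** P = \<Gamma> - P ** \<Gamma>"
    using D G by (simp_all add: algebra_simps)
  \<comment> \<open>This moves \<open>P\<close> to the left past a tangent factor inside a
    left-associated product, so that all terms reach a common form and cancel.\<close>
  have right: "X ** Y ** P = X ** Y - X ** P ** Y" if "Y ** P = Y - P ** Y" for X Y :: "'n sqmat"
  proof -
    have "X ** Y ** P = X ** (Y ** P)" by (simp only: matrix_mul_assoc)
    then show ?thesis by (simp only: that matrix_diff_ldistrib matrix_mul_assoc)
  qed
  show ?thesis
    unfolding commutator_def matrix_ring_simps
    by (simp add: matrix_ring_simps DP GP right[OF DP] right[OF GP] PP idempotent_assoc[OF PP])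
qed

lemma commutator_skew:
  assumes "transpose A = A" "transpose B = B"
  shows "transpose (commutator A B) = - commutator A B"
  using assms by (simp add: commutator_def transpose_diff_mat matrix_transpose_mul)

lemma Gr_exp_conj:
  assumes "transpose A = - A" "P \<in> Gr p"
  shows "exp_conj A P t \<in> Gr p"
  using assms by (simp add: Gr_def exp_conj_mult rank_exp_conj transpose_exp_conj_skew)

lemma gr_tangent_exp_conj:
  assumes "transpose A = - A" "\<Delta> \<in> gr_tangent P"
  shows "exp_conj A \<Delta> t \<in> gr_tangent (exp_conj A P t)"
  using assms by (simp add: gr_tangent_def exp_conj_mult exp_conj_add transpose_exp_conj_skew)

text \<open>Conjugation is an algebra automorphism fixing \<open>mat 1\<close>, and
  \<open>gr_proj\<close> is built from sums, differences and products.\<close>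

lemma gr_proj_exp_conj: "gr_proj (exp_conj A P t) (exp_conj A S t) = exp_conj A (gr_proj P S) t"
proof -
  have "mat 1 - exp_conj A P t = exp_conj A (mat 1 - P) t"
    by (simp flip: exp_conj_diff)
  then show ?thesis by (simp add: gr_proj_def exp_conj_mult exp_conj_add)
qed

lemma gr_tangent_diff: "\<Delta> \<in> gr_tangent P \<Longrightarrow> \<Delta>' \<in> gr_tangent P \<Longrightarrow> \<Delta> - \<Delta>' \<in> gr_tangent P"
  by (auto simp: gr_tangent_def matrix_ring_simps transpose_diff_mat algebra_simps)

lemma gr_tangent_scaleR:
  assumes "\<Delta> \<in> gr_tangent P"
  shows "t *\<^sub>R \<Delta> \<in> gr_tangent P"
  using assms
  by (auto simp: gr_tangent_def mat.scaleR_left mat.scaleR_right transpose_scalar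
      simp flip: scaleR_add_right)

lemma trace_mult_symmetric:
  fixes A B :: "'n::finite sqmat"
  assumes "transpose B = B"
  shows "trace (A ** B) = A \<bullet> B"
proof -
  have "B $ i $ j = B $ j $ i" for i j
    using assms by (metis transpose_def vec_lambda_beta)
  then show ?thesis
    by (simp add: trace_def matrix_matrix_mult_def inner_vec_def)
qed

section \<open>Parallel fields and geodesics\<close>

lemma parallel_field_unique:
  assumes "\<And>t. \<gamma> t \<in> Gr p"
    and V: "gr_parallel_field \<gamma> V" and W: "gr_parallel_field \<gamma> W" and "V 0 = W 0"
  shows "V = W"
proof
  fix t
  let ?D = "\<lambda>t. V t - W t"
  have D': "(?D has_vector_derivative velocity V t - velocity W t) (at t)" for t
    using V W unfolding gr_parallel_field_def
    by (intro derivative_intros smooth_curve_has_vector_derivative) auto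
  have "((\<lambda>t. ?D t \<bullet> ?D t) has_vector_derivative 0) (at t)" for t
  proof -
    let ?S = "velocity V t - velocity W t"
    have tangent: "?D t \<in> gr_tangent (\<gamma> t)"
      using V W by (auto simp: gr_parallel_field_def intro: gr_tangent_diff)
    \<comment> \<open>The derivative of the difference is thus normal, while the difference itself
      is tangent; half the derivative of its squared norm is their inner product.\<close>
    have "gr_proj (\<gamma> t) ?S = gr_proj (\<gamma> t) (velocity V t) - gr_proj (\<gamma> t) (velocity W t)"
      by (simp add: gr_proj_def matrix_ring_simps)
    then have "gr_proj (\<gamma> t) ?S = 0"
      using V W by (simp add: gr_parallel_field_def gr_covariant_deriv_def)
    then have "trace (?S ** ?D t) = 0"
      using gr_proj_orthogonal[OF assms(1) tangent, of ?S] by (simp add: gr_metric_def)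
    moreover have "transpose (?D t) = ?D t"
      using tangent by (simp add: gr_tangent_def)
    ultimately have "?S \<bullet> ?D t = 0"
      using trace_mult_symmetric by metis
    then show ?thesis
      by (intro has_vector_derivative_eq_rhs[OF bounded_bilinear.has_vector_derivative[OF
              bounded_bilinear_inner D' D']]) (simp add: inner_commute)
  qed
  from constant_if_vector_derivative_zero[OF this, of t 0] show "V t = W t"
    using \<open>V 0 = W 0\<close> by simp
qed

text \<open>Equivariance under conjugation reduces tangency and the vanishing covariant derivative
  at every time to algebra at \<open>P\<close>.\<close>

lemma parallel_field_exp_conj:
  assumes P: "P \<in> Gr p" and D: "\<Delta> \<in> gr_tangent P" and G: "\<Gamma> \<in> gr_tangent P"
  shows "gr_parallel_field (exp_conj (commutator \<Gamma> P) P) (exp_conj (commutator \<Gamma> P) \<Delta>)"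
proof -
  have PP: "P ** P = P" using P by (simp add: Gr_def)
  have skew: "transpose (commutator \<Gamma> P) = - commutator \<Gamma> P"
    using P G by (intro commutator_skew) (auto simp: Gr_def gr_tangent_def)
  have "gr_proj P (commutator (commutator \<Gamma> P) \<Delta>) = 0"
    using D G by (simp add: gr_proj_eq_0_iff_commute[OF PP] commutator_tangent_normal[OF PP] gr_tangent_def)
  then show ?thesis
    by (simp add: gr_parallel_field_def gr_covariant_deriv_def smooth_curve_exp_conj
        gr_tangent_exp_conj[OF skew D] velocity_exp_conj gr_proj_exp_conj)
qed

lemma velocity_exp_conj_geodesic:
  assumes "P \<in> Gr p" and "\<Gamma> \<in> gr_tangent P"
  shows "velocity (exp_conj (commutator \<Gamma> P) P) = exp_conj (commutator \<Gamma> P) \<Gamma>"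
  using assms by (simp add: velocity_exp_conj commutator_commutator_tangent Gr_def gr_tangent_def)

lemma geodesic_exp_conj:
  assumes P: "P \<in> Gr p" and G: "\<Gamma> \<in> gr_tangent P"
  shows "gr_geodesic p (exp_conj (commutator \<Gamma> P) P)"
proof -
  have "transpose (commutator \<Gamma> P) = - commutator \<Gamma> P"
    using P G by (intro commutator_skew) (auto simp: Gr_def gr_tangent_def)
  then show ?thesis
    using parallel_field_exp_conj[OF P G G]
    by (simp add: gr_geodesic_def gr_parallel_field_def smooth_curve_exp_conj Gr_exp_conj[OF _ P]
        velocity_exp_conj_geodesic[OF P G])
qed

lemma geodesic_eq_exp_conj:
  assumes geodesic: "gr_geodesic p \<gamma>" and "\<gamma> 0 = P" and "velocity \<gamma> 0 = \<Gamma>"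
  shows "\<gamma> = exp_conj (commutator \<Gamma> P) P"
proof -
  let ?v = "velocity \<gamma>" and ?a = "velocity (velocity \<gamma>)"
  have smooth: "smooth_curve \<gamma>" and gg: "\<gamma> t ** \<gamma> t = \<gamma> t"
    and normal: "gr_proj (\<gamma> t) (?a t) = 0" for t
    using geodesic by (auto simp: gr_geodesic_def Gr_def gr_covariant_deriv_def)
  note v = smooth_curve_has_vector_derivative(1)[OF smooth]
    and a = smooth_curve_has_vector_derivative(2)[OF smooth]
  \<comment> \<open>This differentiates
    \<open>\<gamma> t ** \<gamma> t = \<gamma> t\<close>.\<close>
  have tangent: "?v t ** \<gamma> t + \<gamma> t ** ?v t = ?v t" for t
    using vector_derivative_at[OF mat.has_vector_derivative[OF v v], of t]
    by (simp add: gg vector_derivative_at[OF v] add.commute)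
  have "((\<lambda>t. commutator (?v t) (\<gamma> t)) has_vector_derivative 0) (at t)" for t
  proof -
    \<comment> \<open>In the derivative of \<open>[?v, \<gamma>]\<close> the two terms
      \<open>?v t ** ?v t\<close> cancel, leaving \<open>[?a, \<gamma>]\<close>.\<close>
    have "commutator (?a t) (\<gamma> t) = 0"
      using normal gg by (simp add: gr_proj_eq_0_iff_commute)
    then show ?thesis
      unfolding commutator_def
      by (intro has_vector_derivative_eq_rhs[OF has_vector_derivative_diff[OF
              mat.has_vector_derivative[OF a v] mat.has_vector_derivative[OF v a]]]) simp
  qed
  from constant_if_vector_derivative_zero[OF this, of _ 0]
  have "commutator (?v t) (\<gamma> t) = commutator \<Gamma> P" for t
    using assms by simp
  then have "commutator (commutator \<Gamma> P) (\<gamma> t) = ?v t" for t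
    using commutator_commutator_tangent[OF gg tangent] by metis
  then have "(\<gamma> has_vector_derivative commutator (commutator \<Gamma> P) (\<gamma> t)) (at t)" for t
    using v by simp
  from eq_exp_conj_if_commutator_derivative[OF this] show ?thesis
    using \<open>\<gamma> 0 = P\<close> by auto
qed

lemma gr_exp_eq_exp_conj:
  assumes P: "P \<in> Gr p" and G: "\<Gamma> \<in> gr_tangent P"
  shows "gr_exp p P \<Gamma> = exp_conj (commutator \<Gamma> P) P 1"
proof -
  have "(THE \<gamma>. gr_geodesic p \<gamma> \<and> \<gamma> 0 = P \<and> velocity \<gamma> 0 = \<Gamma>) = exp_conj (commutator \<Gamma> P) P"
    using geodesic_exp_conj[OF P G] velocity_exp_conj_geodesic[OF P G] geodesic_eq_exp_conj
    by (intro the_equality) auto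
  then show ?thesis by (simp add: gr_exp_def)
qed

text \<open>The generator is linear in \<open>\<Gamma>\<close>, so scaling the velocity by
  \<open>t\<close> and stopping at time 1 is the same as running the original geodesic to time
  \<open>t\<close>.\<close>

lemma gr_exp_scaleR_eq_exp_conj:
  assumes "P \<in> Gr p" and "\<Gamma> \<in> gr_tangent P"
  shows "gr_exp p P (t *\<^sub>R \<Gamma>) = exp_conj (commutator \<Gamma> P) P t"
proof -
  have "commutator (t *\<^sub>R \<Gamma>) P = t *\<^sub>R commutator \<Gamma> P"
    by (simp add: commutator_def mat.scaleR_left mat.scaleR_right scaleR_diff_right)
  then show ?thesis
    using gr_exp_eq_exp_conj[OF assms(1) gr_tangent_scaleR[OF assms(2)], of t]
    by (simp add: exp_conj_scaleR)
qed

text \<open>Uniqueness of parallel fields makes the definite description in the transport pick out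
  any parallel field with the right initial value.\<close>

lemma gr_parallel_transport_eqI:
  assumes "\<And>t. \<gamma> t \<in> Gr p" and "gr_parallel_field \<gamma> V"
  shows "gr_parallel_transport \<gamma> (V 0) = V"
  unfolding gr_parallel_transport_def
  using assms by (blast intro: the_equality parallel_field_unique)

theorem proposition3p5:
  fixes P \<Delta> \<Gamma> :: "real ^ 'n ^ 'n" and p :: nat and t :: real
  assumes "1 \<le> p" and "p \<le> CARD('n)"
    and "P \<in> Gr p"
    and "\<Delta> \<in> gr_tangent P" and "\<Gamma> \<in> gr_tangent P"
  shows "gr_exp p P (t *\<^sub>R \<Gamma>) =
           mat_exp (t *\<^sub>R commutator \<Gamma> P) ** P ** mat_exp ((- t) *\<^sub>R commutator \<Gamma> P) \<and>
         gr_parallel_transport (\<lambda>s. gr_exp p P (s *\<^sub>R \<Gamma>)) \<Delta> t =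
           mat_exp (t *\<^sub>R commutator \<Gamma> P) ** \<Delta> ** mat_exp ((- t) *\<^sub>R commutator \<Gamma> P)"
proof -
  let ?A = "commutator \<Gamma> P"
  have geodesic: "gr_exp p P (s *\<^sub>R \<Gamma>) = exp_conj ?A P s" for s
    by (rule gr_exp_scaleR_eq_exp_conj[OF assms(3,5)])
  have "exp_conj ?A P s \<in> Gr p" for s
    using geodesic_exp_conj[OF assms(3,5)] by (simp add: gr_geodesic_def)
  from gr_parallel_transport_eqI[OF this parallel_field_exp_conj[OF assms(3-5)]]
  have "gr_parallel_transport (exp_conj ?A P) \<Delta> = exp_conj ?A \<Delta>" by simp
  then show ?thesis
    by (simp add: geodesic exp_conj_def[symmetric])
qed

end
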